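(* Let $\omega\in\mathbb{R}$ and $\gamma\in(-1,1]$ be such that $D:=2\omega(\gamma^2-1)+\gamma-3\neq0$ and $-2(3+2\omega)\big(\omega(3\gamma+1)(\gamma-1)-2\big)\ge0$, and let $t_0\in\mathbb{R}$. Put $$a_2=-\frac{(\gamma-1)(\omega(\gamma-1)-1)}{D},\qquad n=-\frac{(3\gamma-1)(\gamma-1)}{D},\qquad \rho_0=-\frac{(3+2\omega)^2(\gamma-1)^3}{8\pi D^2},$$ $$m=\frac{(\gamma-1)\sqrt{-2(3+2\omega)\big(\omega(3\gamma+1)(\gamma-1)-2\big)}}{2D},\qquad \alpha=(1+2a_2)(1+\gamma).$$ Then, for $t>-t_0$, the functions $$a=t+t_0,\quad b=d=(t+t_0)^{a_2},\quad \rho=\rho_0(t+t_0)^{-\alpha},\quad \phi=(t+t_0)^n,\quad \Lambda\equiv0$$ form a solution of the Bianchi $\mathrm{VI}_0$ scalar-tensor (Brans-Dicke with $\Lambda(\phi)$) field equations with $b=d$, constant coupling $\omega$ and equation of state $p=\gamma\rho$ (listed in the context).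
   Context: A prime denotes $d/dt$. The unknowns are the scale factors $a(t)$ and $b(t)=d(t)$ of the Bianchi $\mathrm{VI}_0$ metric with structure parameter $m$, $ds^2=-dt^2+a^2dx^2+b^2(\cosh 2mx\,dy^2-2\sinh 2mx\,dy\,dz+\cosh 2mx\,dz^2)$, the energy density $\rho(t)$ of a perfect fluid with pressure $p=\gamma\rho$, the scalar field $\phi(t)>0$ and the function $\Lambda(\phi)$. With $H=\frac{a'}{a}+2\frac{b'}{b}$, the field equations are: $$2\frac{a'}{a}\frac{b'}{b}+\Big(\frac{b'}{b}\Big)^2-\frac{m^2}{a^2}=\frac{8\pi}{\phi}\rho-H\frac{\phi'}{\phi}+\frac{\omega}{2}\Big(\frac{\phi'}{\phi}\Big)^2+\Lambda(\phi),$$ $$2\frac{b''}{b}+\Big(\frac{b'}{b}\Big)^2+\frac{m^2}{a^2}=-\frac{8\pi}{\phi}p-2\frac{\phi'}{\phi}\frac{b'}{b}-\frac{\omega}{2}\Big(\frac{\phi'}{\phi}\Big)^2-\frac{\phi''}{\phi}+\Lambda(\phi),$$ $$\frac{a''}{a}+\frac{b''}{b}+\frac{a'}{a}\frac{b'}{b}-\frac{m^2}{a^2}=-\frac{8\pi}{\phi}p-\frac{\phi'}{\phi}\Big(\frac{a'}{a}+\frac{b'}{b}\Big)-\frac{\omega}{2}\Big(\frac{\phi'}{\phi}\Big)^2-\frac{\phi''}{\phi}+\Lambda(\phi),$$ $$(3+2\omega)\Big(\frac{\phi''}{\phi}+H\frac{\phi'}{\phi}\Big)-2\Big(\Lambda-\phi\frac{d\Lambda}{d\phi}\Big)=\frac{8\pi}{\phi}(\rho-3p),\qquad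 \rho'+(\rho+p)H=0 .$$ *)

theory Defs
  imports "HOL-Analysis.Analysis"
begin

definition hubble :: "(real \<Rightarrow> real) \<Rightarrow> (real \<Rightarrow> real) \<Rightarrow> real \<Rightarrow> real" where
  "hubble a b t = deriv a t / a t + 2 * (deriv b t / b t)"

definition twice_differentiable_at :: "(real \<Rightarrow> real) \<Rightarrow> real \<Rightarrow> bool" where
  "twice_differentiable_at f t \<longleftrightarrow> f differentiable (at t) \<and> deriv f differentiable (at t)"

text \<open>
  Scalar-tensor (Brans-Dicke with a potential \<open>\<Lambda>(\<phi>)\<close>) field equations, at time \<open>t\<close>, for the metric
  \<open>ds^2 = - dt^2 + a^2 dx^2 + b^2 (cosh (2 m x) dy^2 - 2 sinh (2 m x) dy dz + cosh (2 m x) dz^2)\<close>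
  and a perfect fluid of energy density \<open>\<rho>\<close> and pressure \<open>p\<close>.  The potential \<open>\<Lambda>\<close> is a function of
  the value of the scalar field, so its derivative is taken in that variable and evaluated
  at \<open>\<phi> t\<close>.
\<close>

definition bianchi_VI0_field_equations_at ::
    "real \<Rightarrow> real \<Rightarrow> (real \<Rightarrow> real) \<Rightarrow> (real \<Rightarrow> real) \<Rightarrow> (real \<Rightarrow> real) \<Rightarrow> (real \<Rightarrow> real)
      \<Rightarrow> (real \<Rightarrow> real) \<Rightarrow> (real \<Rightarrow> real) \<Rightarrow> real \<Rightarrow> bool" where
  "bianchi_VI0_field_equations_at \<omega> m a b \<rho> p \<phi> \<Lambda> t \<longleftrightarrow>
     2 * (deriv a t / a t) * (deriv b t / b t) + (deriv b t / b t)^2 - m^2 / (a t)^2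
       = 8 * pi / \<phi> t * \<rho> t - hubble a b t * (deriv \<phi> t / \<phi> t)
         + \<omega> / 2 * (deriv \<phi> t / \<phi> t)^2 + \<Lambda> (\<phi> t)
   \<and> 2 * (deriv (deriv b) t / b t) + (deriv b t / b t)^2 + m^2 / (a t)^2
       = - (8 * pi / \<phi> t * p t) - 2 * (deriv \<phi> t / \<phi> t) * (deriv b t / b t)
         - \<omega> / 2 * (deriv \<phi> t / \<phi> t)^2 - deriv (deriv \<phi>) t / \<phi> t + \<Lambda> (\<phi> t)
   \<and> deriv (deriv a) t / a t + deriv (deriv b) t / b t
         + (deriv a t / a t) * (deriv b t / b t) - m^2 / (a t)^2
       = - (8 * pi / \<phi> t * p t) - (deriv \<phi> t / \<phi> t) * (deriv a t / a t + deriv b t / b t)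
         - \<omega> / 2 * (deriv \<phi> t / \<phi> t)^2 - deriv (deriv \<phi>) t / \<phi> t + \<Lambda> (\<phi> t)
   \<and> (3 + 2 * \<omega>) * (deriv (deriv \<phi>) t / \<phi> t + hubble a b t * (deriv \<phi> t / \<phi> t))
         - 2 * (\<Lambda> (\<phi> t) - \<phi> t * deriv \<Lambda> (\<phi> t))
       = 8 * pi / \<phi> t * (\<rho> t - 3 * p t)
   \<and> deriv \<rho> t + (\<rho> t + p t) * hubble a b t = 0"

text \<open>
  The differentiability clauses are needed because \<^const>\<open>deriv\<close> is a total operator whose value at
  a point of non-differentiability is unspecified.  The three scale factors \<open>a\<close>, \<open>b\<close>, \<open>d\<close> are
  required to satisfy \<open>b = d\<close>, and the fluid has \<open>p = \<gamma> \<rho>\<close>.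
\<close>

definition bianchi_VI0_solution_on ::
    "real set \<Rightarrow> real \<Rightarrow> real \<Rightarrow> real \<Rightarrow> (real \<Rightarrow> real) \<Rightarrow> (real \<Rightarrow> real) \<Rightarrow> (real \<Rightarrow> real)
      \<Rightarrow> (real \<Rightarrow> real) \<Rightarrow> (real \<Rightarrow> real) \<Rightarrow> (real \<Rightarrow> real) \<Rightarrow> bool" where
  "bianchi_VI0_solution_on T \<omega> \<gamma> m a b d \<rho> \<phi> \<Lambda> \<longleftrightarrow>
     open T \<and>
     (\<forall>t\<in>T.
        a t > 0 \<and> b t > 0 \<and> d t = b t \<and> \<phi> t > 0
      \<and> twice_differentiable_at a t \<and> twice_differentiable_at b t \<and> twice_differentiable_at \<phi> t
      \<and> \<rho> differentiable (at t) \<and> \<Lambda> differentiable (at (\<phi> t))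
      \<and> bianchi_VI0_field_equations_at \<omega> m a b \<rho> (\<lambda>s. \<gamma> * \<rho> s) \<phi> \<Lambda> t)"

end

theory Submission
  imports Defs
begin

text \<open>
  For power laws in \<open>\<tau> = t + t\<^sub>0\<close> every term of the gravitational and scalar equations is a
  constant times \<open>\<tau>\<^sup>-\<^sup>2\<close>, provided that \<open>\<rho> / \<phi>\<close> scales like \<open>\<tau>\<^sup>-\<^sup>2\<close>, that is, \<open>\<alpha> + n = 2\<close>.
  The conservation law holds because \<open>\<alpha> = (1 + 2 a\<^sub>2) (1 + \<gamma>)\<close>.  What remains are four
  polynomial identities in \<open>\<omega>\<close> and \<open>\<gamma>\<close>, obtained by clearing the denominator \<open>D\<^sup>2\<close>.
\<close>

lemma has_real_derivative_shifted_powr: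
  fixes c k t\<^sub>0 t :: real
  assumes "t > - t\<^sub>0"
  shows "((\<lambda>s. c * (s + t\<^sub>0) powr k) has_real_derivative c * k * (t + t\<^sub>0) powr (k - 1)) (at t)"
  using assms by (auto intro!: derivative_eq_intros)

text \<open>The closed form of the first derivative is established only where the base is positive.
  It therefore replaces \<open>deriv\<close> on an open half-line around \<open>t\<close>, not as an
  equality of functions, and is differentiated again as \<open>k\<close> times a power.\<close>

lemma has_real_derivative_deriv_shifted_powr:
  fixes k t\<^sub>0 t :: real
  assumes "t > - t\<^sub>0"
  shows "(deriv (\<lambda>s. (s + t\<^sub>0) powr k) has_real_derivative
           k * (k - 1) * (t + t\<^sub>0) powr (k - 2)) (at t)"
proof (rule has_field_derivative_transform_within_open)
  show "((\<lambda>s. k * (s + t\<^sub>0) powr (k - 1)) has_real_derivative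
          k * (k - 1) * (t + t\<^sub>0) powr (k - 2)) (at t)"
    using has_real_derivative_shifted_powr[OF assms, of k "k - 1"] by simp
  show "k * (s + t\<^sub>0) powr (k - 1) = deriv (\<lambda>s. (s + t\<^sub>0) powr k) s" if "s \<in> {- t\<^sub>0<..}" for s
    using has_real_derivative_shifted_powr[of t\<^sub>0 s 1 k] that by (simp add: DERIV_imp_deriv)
qed (use assms in auto)

lemma twice_differentiable_at_shifted_powr:
  fixes k t\<^sub>0 t :: real
  assumes "t > - t\<^sub>0"
  shows "twice_differentiable_at (\<lambda>s. (s + t\<^sub>0) powr k) t"
  using has_real_derivative_shifted_powr[OF assms, of 1 k]
    has_real_derivative_deriv_shifted_powr[OF assms, of k]
  by (auto simp: twice_differentiable_at_def real_differentiable_def)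

text \<open>The gravitational and scalar equations see a power-law factor only through these two
  quotients, in which the power itself cancels.\<close>

lemma deriv_shifted_powr_quotients:
  fixes k t\<^sub>0 t :: real
  assumes "t > - t\<^sub>0"
  shows "deriv (\<lambda>s. (s + t\<^sub>0) powr k) t / (t + t\<^sub>0) powr k = k / (t + t\<^sub>0)"
    and "deriv (deriv (\<lambda>s. (s + t\<^sub>0) powr k)) t / (t + t\<^sub>0) powr k = k * (k - 1) / (t + t\<^sub>0)^2"
proof -
  have pos: "t + t\<^sub>0 > 0" using assms by simp
  have "deriv (\<lambda>s. (s + t\<^sub>0) powr k) t = k * (t + t\<^sub>0) powr (k - 1)"
    using has_real_derivative_shifted_powr[OF assms, of 1 k] by (simp add: DERIV_imp_deriv)
  then show "deriv (\<lambda>s. (s + t\<^sub>0) powr k) t / (t + t\<^sub>0) powr k = k / (t + t\<^sub>0)"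
    using pos by (simp add: powr_diff)
  have "deriv (deriv (\<lambda>s. (s + t\<^sub>0) powr k)) t = k * (k - 1) * (t + t\<^sub>0) powr (k - 2)"
    using has_real_derivative_deriv_shifted_powr[OF assms] by (rule DERIV_imp_deriv)
  then show "deriv (deriv (\<lambda>s. (s + t\<^sub>0) powr k)) t / (t + t\<^sub>0) powr k = k * (k - 1) / (t + t\<^sub>0)^2"
    using pos by (simp add: powr_diff)
qed

text \<open>Separates calculus from algebra: \<open>e1\<close> to \<open>e4\<close> are the first
  four field equations, in order, with the common factor \<open>1 / \<tau>^2\<close>
  removed.\<close>

lemma power_law_bianchi_VI0_solution:
  fixes \<omega> \<gamma> t\<^sub>0 a\<^sub>2 n \<rho>\<^sub>0 m \<alpha> :: real
  assumes scaling: "\<alpha> + n = 2"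
    and conservation: "\<alpha> = (1 + 2 * a\<^sub>2) * (1 + \<gamma>)"
    and e1: "2 * a\<^sub>2 + a\<^sub>2^2 - m^2 = 8 * pi * \<rho>\<^sub>0 - (1 + 2 * a\<^sub>2) * n + \<omega> / 2 * n^2"
    and e2: "2 * (a\<^sub>2 * (a\<^sub>2 - 1)) + a\<^sub>2^2 + m^2
               = - (8 * pi * (\<gamma> * \<rho>\<^sub>0)) - 2 * n * a\<^sub>2 - \<omega> / 2 * n^2 - n * (n - 1)"
    and e3: "a\<^sub>2 * (a\<^sub>2 - 1) + a\<^sub>2 - m^2
               = - (8 * pi * (\<gamma> * \<rho>\<^sub>0)) - n * (1 + a\<^sub>2) - \<omega> / 2 * n^2 - n * (n - 1)"
    and e4: "(3 + 2 * \<omega>) * (n * (n - 1) + (1 + 2 * a\<^sub>2) * n) = 8 * pi * (\<rho>\<^sub>0 - 3 * (\<gamma> * \<rho>\<^sub>0))"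
  shows "bianchi_VI0_solution_on {- t\<^sub>0<..} \<omega> \<gamma> m
           (\<lambda>t. t + t\<^sub>0)
           (\<lambda>t. (t + t\<^sub>0) powr a\<^sub>2)
           (\<lambda>t. (t + t\<^sub>0) powr a\<^sub>2)
           (\<lambda>t. \<rho>\<^sub>0 * (t + t\<^sub>0) powr (- \<alpha>))
           (\<lambda>t. (t + t\<^sub>0) powr n)
           (\<lambda>_. 0)"
  unfolding bianchi_VI0_solution_on_def
proof (intro conjI ballI)
  fix t assume "t \<in> {- t\<^sub>0<..}"
  then have t: "t > - t\<^sub>0" and pos: "t + t\<^sub>0 > 0" by simp_all
  define \<tau> where "\<tau> = t + t\<^sub>0"
  have \<tau>: "\<tau> > 0" using pos by (simp add: \<tau>_def)
  \<comment> \<open>For the affine factor the derivative is known on the whole line, so an equality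
    of functions is possible and also rewrites inside the second derivative.\<close>
  have deriv_a: "deriv (\<lambda>t. t + t\<^sub>0) = (\<lambda>_. 1)"
    by (rule ext, rule DERIV_imp_deriv) (auto intro!: derivative_eq_intros)
  show "twice_differentiable_at (\<lambda>t. t + t\<^sub>0) t"
    by (simp add: twice_differentiable_at_def deriv_a)
  show "twice_differentiable_at (\<lambda>t. (t + t\<^sub>0) powr a\<^sub>2) t"
    "twice_differentiable_at (\<lambda>t. (t + t\<^sub>0) powr n) t"
    using t by (rule twice_differentiable_at_shifted_powr)+
  note deriv_\<rho> = has_real_derivative_shifted_powr[OF t, of \<rho>\<^sub>0 "- \<alpha>"]
  show "(\<lambda>t. \<rho>\<^sub>0 * (t + t\<^sub>0) powr - \<alpha>) differentiable at t"
    using deriv_\<rho> real_differentiable_def by blast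
  have d\<rho>: "deriv (\<lambda>t. \<rho>\<^sub>0 * (t + t\<^sub>0) powr - \<alpha>) t = - \<alpha> * \<rho>\<^sub>0 * \<tau> powr - \<alpha> / \<tau>"
    using DERIV_imp_deriv[OF deriv_\<rho>] pos by (simp add: powr_diff \<tau>_def)
  have "\<alpha> = 2 - n" using scaling by simp
  then have ratio: "\<tau> powr - \<alpha> = \<tau> powr n / \<tau>^2"
    using \<tau> by (simp add: powr_diff)
  \<comment> \<open>The coefficient is left open because the density needs
    \<open>c = \<rho>\<^sub>0\<close> and the pressure \<open>c = \<gamma> * \<rho>\<^sub>0\<close>;
    \<open>mult.assoc\<close> below regroups the pressure to this shape.\<close>
  then have fluid: "8 * pi / \<tau> powr n * (c * \<tau> powr - \<alpha>) = 8 * pi * c / \<tau>^2" for c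
    using \<tau> by simp
  note quotients = deriv_shifted_powr_quotients[OF t, folded \<tau>_def]
  have hub: "hubble (\<lambda>t. t + t\<^sub>0) (\<lambda>t. (t + t\<^sub>0) powr a\<^sub>2) t = (1 + 2 * a\<^sub>2) / \<tau>"
    unfolding hubble_def deriv_a \<tau>_def[symmetric] quotients by (simp add: add_divide_distrib)
  note expand = deriv_a \<tau>_def[symmetric] quotients hub
  show "bianchi_VI0_field_equations_at \<omega> m (\<lambda>t. t + t\<^sub>0) (\<lambda>t. (t + t\<^sub>0) powr a\<^sub>2)
      (\<lambda>t. \<rho>\<^sub>0 * (t + t\<^sub>0) powr - \<alpha>) (\<lambda>s. \<gamma> * (\<rho>\<^sub>0 * (s + t\<^sub>0) powr - \<alpha>))
      (\<lambda>t. (t + t\<^sub>0) powr n) (\<lambda>_. 0) t"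
    unfolding bianchi_VI0_field_equations_at_def expand
  proof (intro conjI)
    show "2 * (1 / \<tau>) * (a\<^sub>2 / \<tau>) + (a\<^sub>2 / \<tau>)^2 - m^2 / \<tau>^2
        = 8 * pi / \<tau> powr n * (\<rho>\<^sub>0 * \<tau> powr - \<alpha>) - (1 + 2 * a\<^sub>2) / \<tau> * (n / \<tau>)
          + \<omega> / 2 * (n / \<tau>)^2 + 0"
      using arg_cong[OF e1, of "\<lambda>x. x / \<tau>^2"] unfolding fluid
      by (simp add: add_divide_distrib diff_divide_distrib power2_eq_square distrib_right)
    show "2 * (a\<^sub>2 * (a\<^sub>2 - 1) / \<tau>^2) + (a\<^sub>2 / \<tau>)^2 + m^2 / \<tau>^2
        = - (8 * pi / \<tau> powr n * (\<gamma> * (\<rho>\<^sub>0 * \<tau> powr - \<alpha>))) - 2 * (n / \<tau>) * (a\<^sub>2 / \<tau>)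
          - \<omega> / 2 * (n / \<tau>)^2 - n * (n - 1) / \<tau>^2 + 0"
      using arg_cong[OF e2, of "\<lambda>x. x / \<tau>^2"] unfolding mult.assoc[symmetric, of \<gamma>] fluid
      by (simp add: add_divide_distrib diff_divide_distrib power2_eq_square)
    \<comment> \<open>The term \<open>deriv (\<lambda>_. 1) t\<close> is the second derivative of
      the affine scale factor, hence zero.\<close>
    show "deriv (\<lambda>_. 1) t / \<tau> + a\<^sub>2 * (a\<^sub>2 - 1) / \<tau>^2 + 1 / \<tau> * (a\<^sub>2 / \<tau>) - m^2 / \<tau>^2
        = - (8 * pi / \<tau> powr n * (\<gamma> * (\<rho>\<^sub>0 * \<tau> powr - \<alpha>))) - n / \<tau> * (1 / \<tau> + a\<^sub>2 / \<tau>)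
          - \<omega> / 2 * (n / \<tau>)^2 - n * (n - 1) / \<tau>^2 + 0"
      using arg_cong[OF e3, of "\<lambda>x. x / \<tau>^2"] unfolding mult.assoc[symmetric, of \<gamma>] fluid
      by (simp add: add_divide_distrib diff_divide_distrib power2_eq_square distrib_left)
    have "8 * pi / \<tau> powr n * (\<rho>\<^sub>0 * \<tau> powr - \<alpha> - 3 * (\<gamma> * (\<rho>\<^sub>0 * \<tau> powr - \<alpha>)))
        = 8 * pi * (\<rho>\<^sub>0 - 3 * (\<gamma> * \<rho>\<^sub>0)) / \<tau>^2"
      unfolding fluid[symmetric] by (simp add: algebra_simps)
    moreover have "(3 + 2 * \<omega>) * (n * (n - 1) / \<tau>^2 + (1 + 2 * a\<^sub>2) / \<tau> * (n / \<tau>))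
        = (3 + 2 * \<omega>) * (n * (n - 1) + (1 + 2 * a\<^sub>2) * n) / \<tau>^2"
      using \<tau> by (simp add: field_simps power2_eq_square)
    ultimately show "(3 + 2 * \<omega>) * (n * (n - 1) / \<tau>^2 + (1 + 2 * a\<^sub>2) / \<tau> * (n / \<tau>))
          - 2 * (0 - \<tau> powr n * deriv (\<lambda>_. 0) (\<tau> powr n))
        = 8 * pi / \<tau> powr n * (\<rho>\<^sub>0 * \<tau> powr - \<alpha> - 3 * (\<gamma> * (\<rho>\<^sub>0 * \<tau> powr - \<alpha>)))"
      using e4 by simp
    show "deriv (\<lambda>t. \<rho>\<^sub>0 * (t + t\<^sub>0) powr - \<alpha>) t
        + (\<rho>\<^sub>0 * \<tau> powr - \<alpha> + \<gamma> * (\<rho>\<^sub>0 * \<tau> powr - \<alpha>)) * ((1 + 2 * a\<^sub>2) / \<tau>) = 0"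
    proof -
      \<comment> \<open>The expansion term has coefficient
        \<open>(1 + 2 * a\<^sub>2) * (1 + \<gamma>)\<close>, which is \<alpha> and so cancels the
        derivative of the density.\<close>
      have "(\<rho>\<^sub>0 * \<tau> powr - \<alpha> + \<gamma> * (\<rho>\<^sub>0 * \<tau> powr - \<alpha>)) * ((1 + 2 * a\<^sub>2) / \<tau>)
          = ((1 + 2 * a\<^sub>2) * (1 + \<gamma>)) * \<rho>\<^sub>0 * \<tau> powr - \<alpha> / \<tau>"
        by (simp add: algebra_simps add_divide_distrib)
      then show ?thesis unfolding d\<rho> conservation[symmetric] by simp
    qed
  qed
qed auto

theorem mainTheorem4:
  fixes \<omega> \<gamma> t\<^sub>0 D a\<^sub>2 n \<rho>\<^sub>0 m \<alpha> :: real
  assumes "-1 < \<gamma>" and "\<gamma> \<le> 1"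
    and "D = 2 * \<omega> * (\<gamma>^2 - 1) + \<gamma> - 3" and "D \<noteq> 0"
    and "- 2 * (3 + 2 * \<omega>) * (\<omega> * (3 * \<gamma> + 1) * (\<gamma> - 1) - 2) \<ge> 0"
    and "a\<^sub>2 = - ((\<gamma> - 1) * (\<omega> * (\<gamma> - 1) - 1) / D)"
    and "n = - ((3 * \<gamma> - 1) * (\<gamma> - 1) / D)"
    and "\<rho>\<^sub>0 = - ((3 + 2 * \<omega>)^2 * (\<gamma> - 1)^3 / (8 * pi * D^2))"
    and "m = (\<gamma> - 1) * sqrt (- 2 * (3 + 2 * \<omega>) * (\<omega> * (3 * \<gamma> + 1) * (\<gamma> - 1) - 2)) / (2 * D)"
    and "\<alpha> = (1 + 2 * a\<^sub>2) * (1 + \<gamma>)"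
  shows "bianchi_VI0_solution_on {- t\<^sub>0<..} \<omega> \<gamma> m
           (\<lambda>t. t + t\<^sub>0)
           (\<lambda>t. (t + t\<^sub>0) powr a\<^sub>2)
           (\<lambda>t. (t + t\<^sub>0) powr a\<^sub>2)
           (\<lambda>t. \<rho>\<^sub>0 * (t + t\<^sub>0) powr (- \<alpha>))
           (\<lambda>t. (t + t\<^sub>0) powr n)
           (\<lambda>_. 0)"
proof -
  \<comment> \<open>Absorbing \<open>8 * pi\<close> makes the remaining identities polynomial with
    rational coefficients.\<close>
  define R where "R = 8 * pi * \<rho>\<^sub>0"
  have a: "a\<^sub>2 * D = - ((\<gamma> - 1) * (\<omega> * (\<gamma> - 1) - 1))"
    and n: "n * D = - ((3 * \<gamma> - 1) * (\<gamma> - 1))"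
    and R: "R * D^2 = - ((3 + 2 * \<omega>)^2 * (\<gamma> - 1)^3)"
    using assms(4,6-8) by (simp_all add: R_def)
  \<comment> \<open>Only \<open>m^2\<close> enters the equations, so the root disappears on
    squaring; this is where the sign of the radicand matters. The factor 2 avoids a
    fraction.\<close>
  have m: "2 * (m^2 * D^2) = - ((\<gamma> - 1)^2 * (3 + 2 * \<omega>) * (\<omega> * (3 * \<gamma> + 1) * (\<gamma> - 1) - 2))"
  proof -
    have "m * (2 * D) = (\<gamma> - 1) * sqrt (- 2 * (3 + 2 * \<omega>) * (\<omega> * (3 * \<gamma> + 1) * (\<gamma> - 1) - 2))"
      using assms(4,9) by simp
    then have "(m * (2 * D))^2
        = (\<gamma> - 1)^2 * (- 2 * (3 + 2 * \<omega>) * (\<omega> * (3 * \<gamma> + 1) * (\<gamma> - 1) - 2))"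
      using assms(5) by (simp only: power_mult_distrib real_sqrt_pow2)
    then show ?thesis by algebra
  qed
  have D: "D = 2 * \<omega> * (\<gamma>^2 - 1) + \<gamma> - 3" by fact
  \<comment> \<open>\<open>D^2\<close> clears all denominators; the 2 clears
    \<open>\<omega> / 2\<close> and matches the form of \<open>m\<close>.\<close>
  have clear: "x = y" if "2 * (D^2 * x) = 2 * (D^2 * y)" for x y
    using that assms(4) by simp
  have scaling: "\<alpha> + n = 2"
  proof -
    \<comment> \<open>Here \<open>D + 2 * (a\<^sub>2 * D)\<close> is
      \<open>4 * \<omega> * (\<gamma> - 1) + 3 * \<gamma> - 5\<close>; multiplying by
      \<open>1 + \<gamma>\<close> and adding \<open>n * D\<close> gives
      \<open>2 * D\<close>.\<close>
    have "D * (\<alpha> + n) = D * 2" using a n D assms(10) by algebra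
    then show ?thesis using assms(4) by simp
  qed
  show ?thesis
  proof (rule power_law_bianchi_VI0_solution[OF scaling assms(10)])
    show "2 * a\<^sub>2 + a\<^sub>2^2 - m^2 = 8 * pi * \<rho>\<^sub>0 - (1 + 2 * a\<^sub>2) * n + \<omega> / 2 * n^2"
    proof (rule clear)
      \<comment> \<open>The grouping exposes the products given by \<open>a\<close>,
        \<open>n\<close>, \<open>R\<close> and \<open>m\<close>. They are replaced before
        \<open>D\<close> is expanded, which would hide them; an identity in \<omega> and \<gamma>
        remains.\<close>
      have "4 * (a\<^sub>2 * D) * D + 2 * (a\<^sub>2 * D)^2 - 2 * (m^2 * D^2)
          = 2 * (R * D^2) - 2 * (D + 2 * (a\<^sub>2 * D)) * (n * D) + \<omega> * (n * D)^2"
        unfolding a n R m unfolding D by algebra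
      then show "2 * (D^2 * (2 * a\<^sub>2 + a\<^sub>2^2 - m^2))
          = 2 * (D^2 * (8 * pi * \<rho>\<^sub>0 - (1 + 2 * a\<^sub>2) * n + \<omega> / 2 * n^2))"
        by (simp add: R_def algebra_simps power2_eq_square)
    qed
    show "2 * (a\<^sub>2 * (a\<^sub>2 - 1)) + a\<^sub>2^2 + m^2
        = - (8 * pi * (\<gamma> * \<rho>\<^sub>0)) - 2 * n * a\<^sub>2 - \<omega> / 2 * n^2 - n * (n - 1)"
    proof (rule clear)
      have "4 * ((a\<^sub>2 * D) * ((a\<^sub>2 * D) - D)) + 2 * (a\<^sub>2 * D)^2 + 2 * (m^2 * D^2)
          = - 2 * \<gamma> * (R * D^2) - 4 * (n * D) * (a\<^sub>2 * D) - \<omega> * (n * D)^2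
            - 2 * (n * D) * ((n * D) - D)"
        unfolding a n R m unfolding D by algebra
      then show "2 * (D^2 * (2 * (a\<^sub>2 * (a\<^sub>2 - 1)) + a\<^sub>2^2 + m^2))
          = 2 * (D^2 * (- (8 * pi * (\<gamma> * \<rho>\<^sub>0)) - 2 * n * a\<^sub>2 - \<omega> / 2 * n^2 - n * (n - 1)))"
        by (simp add: R_def algebra_simps power2_eq_square)
    qed
    show "a\<^sub>2 * (a\<^sub>2 - 1) + a\<^sub>2 - m^2
        = - (8 * pi * (\<gamma> * \<rho>\<^sub>0)) - n * (1 + a\<^sub>2) - \<omega> / 2 * n^2 - n * (n - 1)"
    proof (rule clear)
      have "2 * ((a\<^sub>2 * D) * ((a\<^sub>2 * D) - D)) + 2 * (a\<^sub>2 * D) * D - 2 * (m^2 * D^2)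
          = - 2 * \<gamma> * (R * D^2) - 2 * (n * D) * (D + (a\<^sub>2 * D)) - \<omega> * (n * D)^2
            - 2 * (n * D) * ((n * D) - D)"
        unfolding a n R m unfolding D by algebra
      then show "2 * (D^2 * (a\<^sub>2 * (a\<^sub>2 - 1) + a\<^sub>2 - m^2))
          = 2 * (D^2 * (- (8 * pi * (\<gamma> * \<rho>\<^sub>0)) - n * (1 + a\<^sub>2) - \<omega> / 2 * n^2 - n * (n - 1)))"
        by (simp add: R_def algebra_simps power2_eq_square)
    qed
    show "(3 + 2 * \<omega>) * (n * (n - 1) + (1 + 2 * a\<^sub>2) * n) = 8 * pi * (\<rho>\<^sub>0 - 3 * (\<gamma> * \<rho>\<^sub>0))"
    proof (rule clear)
      \<comment> \<open>The bracket is \<open>n * D\<close> times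
        \<open>n * D + 2 * (a\<^sub>2 * D)\<close>, and the latter equals
        \<open>- ((\<gamma> - 1)^2 * (3 + 2 * \<omega>))\<close>. This yields the square and the
        cube in \<open>\<rho>\<^sub>0\<close>.\<close>
      have "2 * (3 + 2 * \<omega>) * ((n * D) * ((n * D) - D) + (D + 2 * (a\<^sub>2 * D)) * (n * D))
          = 2 * (R * D^2) - 6 * \<gamma> * (R * D^2)"
        unfolding a n R m unfolding D by algebra
      then show "2 * (D^2 * ((3 + 2 * \<omega>) * (n * (n - 1) + (1 + 2 * a\<^sub>2) * n)))
          = 2 * (D^2 * (8 * pi * (\<rho>\<^sub>0 - 3 * (\<gamma> * \<rho>\<^sub>0))))"
        by (simp add: R_def algebra_simps power2_eq_square)
    qed
  qed
qed

end
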